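(* Let $l,\lambda\ge0$, $|m|\le l$, $|\mu|\le\lambda$ be integers and let $\alpha$ be the (real) quasi-periodicity parameter. For $n\in\mathbb Z\setminus\{0\}$ put $\mathbf b=(-n,0,0)$. Define $\mathscr D_{l,\lambda}^{m,\mu}(\alpha)=\sum_{n\ne0}n^2H_{l,\lambda}^{m,\mu}(\mathbf b)e^{-in\alpha}$. Then $$\mathscr D_{l,\lambda}^{m,\mu}(\alpha)=(-1)^{\lambda+\mu}\sqrt{\frac{2l+1}{2\lambda+1}}\sqrt{\binom{l+\lambda+\mu-m}{\lambda+\mu}\binom{l+\lambda+m-\mu}{\lambda-\mu}}\sqrt{\frac{4\pi}{2(l+\lambda)+1}}\Big(\mathrm{Li}_{l+\lambda-1}(e^{-i\alpha})Y_{l+\lambda}^{m-\mu}(\tfrac\pi2,\pi)+\mathrm{Li}_{l+\lambda-1}(e^{i\alpha})Y_{l+\lambda}^{m-\mu}(\tfrac\pi2,0)\Big).$$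
   Context: $Y_l^m(\theta,\phi)$ are the $L^2$-orthonormal complex spherical harmonics with Condon–Shortley phase ($\theta$ polar, $\phi$ azimuthal angle). $I_l^m(\mathbf r)=\sqrt{\frac{4\pi}{2l+1}}Y_l^m(\hat{\mathbf r})|\mathbf r|^{-l-1}$, $\hat{\mathbf r}=\mathbf r/|\mathbf r|$, and $H_{l,\lambda}^{m,\mu}(\mathbf b)=(-1)^{\lambda+\mu}\sqrt{\frac{2l+1}{2\lambda+1}}\,I_{l+\lambda}^{m-\mu}(\mathbf b)\sqrt{\binom{l+\lambda+\mu-m}{\lambda+\mu}\binom{l+\lambda+m-\mu}{\lambda-\mu}}$. The polylogarithm is defined by the series $\mathrm{Li}_s(z)=\sum_{k=1}^\infty z^k/k^s$.
   Formalization: The identity is asserted literally only for l+λ≥3, or l+λ=2 with e^{iα}≠1, since otherwise the Li series diverges; for all l,λ it is proved with a damping factor r^{|n|}, 0≤r<1, and, if e^{iα}≠1, in the Abel limit r→1. *)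

theory Defs
  imports "HOL-Analysis.Analysis" "HOL-Computational_Algebra.Polynomial"
begin

text \<open>Associated Legendre functions of order \<open>m \<ge> 0\<close> by the Rodrigues formula; the factor
  \<open>(-1) ^ m\<close> is the Condon--Shortley phase.\<close>

definition legendre_assoc :: "nat \<Rightarrow> nat \<Rightarrow> real \<Rightarrow> real" where
  "legendre_assoc l m x =
     (-1) ^ m * sqrt (1 - x\<^sup>2) ^ m / (2 ^ l * fact l)
       * poly ((pderiv ^^ (l + m)) ([:-1, 0, 1:] ^ l)) x"

definition sph_harm_nonneg :: "nat \<Rightarrow> nat \<Rightarrow> real \<Rightarrow> real \<Rightarrow> complex" where
  "sph_harm_nonneg l m \<theta> \<phi> =
     of_real (sqrt ((2 * real l + 1) / (4 * pi) * (fact (l - m) / fact (l + m)))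
       * legendre_assoc l m (cos \<theta>)) * exp (\<i> * of_real (real m * \<phi>))"

text \<open>Polar angle \<open>\<theta>\<close>, azimuthal angle \<open>\<phi>\<close>. Negative orders follow from
  \<open>Y\<^sub>l\<^sup>-\<^sup>m = (-1)\<^sup>m cnj Y\<^sub>l\<^sup>m\<close>. Only \<open>\<bar>m\<bar> \<le> l\<close> is meaningful.\<close>

definition sph_harm :: "nat \<Rightarrow> int \<Rightarrow> real \<Rightarrow> real \<Rightarrow> complex" where
  "sph_harm l m \<theta> \<phi> =
     (if m \<ge> 0 then sph_harm_nonneg l (nat m) \<theta> \<phi>
      else (-1) ^ nat (- m) * cnj (sph_harm_nonneg l (nat (- m)) \<theta> \<phi>))"

definition sph_harm_dir :: "nat \<Rightarrow> int \<Rightarrow> real ^ 3 \<Rightarrow> complex" where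
  "sph_harm_dir l m u = sph_harm l m (arccos (u $ 3)) (Arg (Complex (u $ 1) (u $ 2)))"

definition irregular_harm :: "nat \<Rightarrow> int \<Rightarrow> real ^ 3 \<Rightarrow> complex" where
  "irregular_harm l m r =
     of_real (sqrt (4 * pi / (2 * real l + 1))) * sph_harm_dir l m (r /\<^sub>R norm r)
       * of_real (norm r powi (- int l - 1))"

text \<open>\<open>\<Lambda>\<close> is the degree usually written as a lower-case lambda.\<close>

definition transl_coeff :: "nat \<Rightarrow> nat \<Rightarrow> int \<Rightarrow> int \<Rightarrow> real ^ 3 \<Rightarrow> complex" where
  "transl_coeff l \<Lambda> m \<mu> b =
     (-1) powi (int \<Lambda> + \<mu>) * of_real (sqrt ((2 * real l + 1) / (2 * real \<Lambda> + 1)))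
       * irregular_harm (l + \<Lambda>) (m - \<mu>) b
       * of_real (sqrt (real (nat (int l + int \<Lambda> + \<mu> - m) choose nat (int \<Lambda> + \<mu>))
                      * real (nat (int l + int \<Lambda> + m - \<mu>) choose nat (int \<Lambda> - \<mu>))))"

definition polylog_term :: "int \<Rightarrow> complex \<Rightarrow> nat \<Rightarrow> complex" where
  "polylog_term s z k = z ^ k / of_nat k powi s"

definition polylog :: "int \<Rightarrow> complex \<Rightarrow> complex" where
  "polylog s z = (\<Sum>k. polylog_term s z (Suc k))"

text \<open>Sums over the nonzero integers: the two half-series are required to converge separately,
  possibly only conditionally (unordered summability would be too strong when the terms decay
  like \<open>1 / \<bar>n\<bar>\<close>).\<close>

definition nonzero_int_summable :: "(int \<Rightarrow> complex) \<Rightarrow> bool" where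
  "nonzero_int_summable f \<longleftrightarrow>
     summable (\<lambda>k. f (int (Suc k))) \<and> summable (\<lambda>k. f (- int (Suc k)))"

definition nonzero_int_suminf :: "(int \<Rightarrow> complex) \<Rightarrow> complex" where
  "nonzero_int_suminf f = (\<Sum>k. f (int (Suc k))) + (\<Sum>k. f (- int (Suc k)))"

definition lattice_term :: "nat \<Rightarrow> nat \<Rightarrow> int \<Rightarrow> int \<Rightarrow> real \<Rightarrow> int \<Rightarrow> complex" where
  "lattice_term l \<Lambda> m \<mu> \<alpha> n =
     (of_int n)\<^sup>2 * transl_coeff l \<Lambda> m \<mu> (vector [- real_of_int n, 0, 0])
       * exp (- (\<i> * of_int n * of_real \<alpha>))"

definition lattice_sum :: "nat \<Rightarrow> nat \<Rightarrow> int \<Rightarrow> int \<Rightarrow> real \<Rightarrow> complex" where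
  "lattice_sum l \<Lambda> m \<mu> \<alpha> = nonzero_int_suminf (lattice_term l \<Lambda> m \<mu> \<alpha>)"

text \<open>The terms of \<open>lattice_sum\<close> have size at most of order \<open>\<bar>n\<bar> powi (1 - l - \<Lambda>)\<close>. On the
  unit circle the polylogarithm series of order \<open>l + \<Lambda> - 1\<close> diverges if \<open>l + \<Lambda> < 2\<close>, and at the
  point 1 also if \<open>l + \<Lambda> = 2\<close>. Abel regularisation (the factor \<open>r ^ \<bar>n\<bar>\<close> with \<open>r < 1\<close>, then
  \<open>r \<rightarrow> 1\<close> from the left) gives the identity a meaning in the divergent cases.\<close>

definition abel_term :: "real \<Rightarrow> (int \<Rightarrow> complex) \<Rightarrow> int \<Rightarrow> complex" where
  "abel_term r f n = of_real r ^ nat \<bar>n\<bar> * f n"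

end

theory Submission imports Defs begin

text \<open>
  The lattice points \<open>(-n, 0, 0)\<close> lie on the first coordinate axis, where the polar angle is
  \<open>\<pi> / 2\<close> and the azimuthal angle is \<open>\<pi>\<close> for \<open>n > 0\<close> and \<open>0\<close> for \<open>n < 0\<close>. On each of the two
  half-lines the spherical harmonic is therefore constant, and the only dependence on \<open>n\<close> is through
  \<open>n\<^sup>2 \<bar>n\<bar> powi (- L - 1) = 1 / \<bar>n\<bar> powi (L - 1)\<close> with \<open>L = l + \<Lambda>\<close>, and through the phase, which is
  the \<open>\<bar>n\<bar>\<close>-th power of \<open>exp (\<mp> \<i> \<alpha>)\<close>. So each half of the lattice sum is, term by
  term, a constant multiple of a polylogarithm series of order \<open>s = L - 1\<close>
  (\<open>lattice_term_pos\<close> and \<open>lattice_term_neg\<close>). The Abel factor \<open>r ^ \<bar>n\<bar>\<close> only replaces the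
  argument \<open>x\<close> of the polylogarithm by \<open>r x\<close>.

  What remains is analysis of \<open>polylog s\<close> on the closed unit disc for \<open>s \<ge> - 1\<close>. For \<open>s \<ge> 2\<close> the series
  converges absolutely. For \<open>s \<ge> 1\<close> its coefficients decrease to 0, and summation by parts shows
  both that it converges at every point of the closed disc other than 1
  (\<open>sums_decreasing_coeff\<close>) and that the sum is continuous there
  (\<open>continuous_on_suminf_decreasing_coeff\<close>), which yields the radial limits. For the two remaining
  orders, \<open>s = 0\<close> and \<open>s = - 1\<close>, the sums inside the disc are the rational functions \<open>x / (1 - x)\<close>
  and \<open>x / (1 - x)\<^sup>2\<close>, which are continuous away from 1 although the series diverge on the unit circle.
\<close>

section \<open>Power series with coefficients decreasing to zero\<close>

lemma norm_difference_term_le: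
  fixes a :: "nat \<Rightarrow> real" and x :: "'a :: real_normed_field"
  assumes dec: "decseq a" and x: "norm x \<le> 1"
  shows "norm (of_real (a k - a (Suc k)) * x ^ Suc k) \<le> a k - a (Suc k)"
proof -
  have "0 \<le> a k - a (Suc k)"
    using dec by (simp add: decseq_Suc_iff)
  moreover have "norm x ^ Suc k \<le> 1"
    using x by (intro power_le_one) auto
  ultimately show ?thesis
    using mult_left_le[of "norm x ^ Suc k" "a k - a (Suc k)"]
    by (simp only: norm_mult norm_power norm_of_real abs_of_nonneg)
qed

text \<open>Dirichlet's test for a geometric factor, with its value. Summation by parts, that is
  multiplication by \<open>1 - x\<close>, turns the coefficients \<open>a k\<close> into the differences
  \<open>a k - a (Suc k)\<close>. These are nonnegative and telescope, so the new series converges absolutely,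
  and it does so uniformly on the closed unit disc.\<close>

lemma sums_decreasing_coeff:
  fixes a :: "nat \<Rightarrow> real" and x :: complex
  assumes dec: "decseq a" and lim: "a \<longlonglongrightarrow> 0" and x: "norm x \<le> 1" "x \<noteq> 1"
  shows "(\<lambda>k. of_real (a k) * x ^ k) sums
           ((of_real (a 0) - (\<Sum>k. of_real (a k - a (Suc k)) * x ^ Suc k)) / (1 - x))"
proof -
  define d where "d k = a k - a (Suc k)" for k
  have sd: "summable d"
    unfolding d_def using telescope_sums'[OF lim] by (rule sums_summable)
  have le: "norm (of_real (d k) * x ^ Suc k) \<le> d k" for k
    unfolding d_def using dec x(1) by (rule norm_difference_term_le)
  have "summable (\<lambda>k. of_real (d k) * x ^ Suc k)"
    by (rule summable_comparison_test'[OF sd le])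
  hence A: "(\<lambda>n. \<Sum>k<n. of_real (d k) * x ^ Suc k) \<longlonglongrightarrow> (\<Sum>k. of_real (d k) * x ^ Suc k)"
    by (rule summable_LIMSEQ)
  have B: "(\<lambda>n. of_real (a n) * x ^ n) \<longlonglongrightarrow> 0"
  proof (rule Lim_null_comparison[OF _ lim], rule always_eventually, rule allI)
    fix n
    have "norm x ^ n \<le> 1" using x by (intro power_le_one) auto
    moreover have "a n \<ge> 0" using dec lim by (rule decseq_ge)
    ultimately show "norm (of_real (a n) * x ^ n) \<le> a n"
      using mult_left_le[of "norm x ^ n" "a n"] by (simp add: norm_mult norm_power)
  qed
  have parts: "(\<Sum>k<n. of_real (a k) * x ^ k) =
      (of_real (a 0) - of_real (a n) * x ^ n - (\<Sum>k<n. of_real (d k) * x ^ Suc k)) / (1 - x)" for n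
  proof -
    have "(1 - x) * (\<Sum>k<n. of_real (a k) * x ^ k) =
      of_real (a 0) - of_real (a n) * x ^ n - (\<Sum>k<n. of_real (d k) * x ^ Suc k)"
      by (induction n) (auto simp: d_def algebra_simps)
    thus ?thesis using x by (simp add: field_simps)
  qed
  have "(\<lambda>n. (of_real (a 0) - of_real (a n) * x ^ n - (\<Sum>k<n. of_real (d k) * x ^ Suc k)) / (1 - x))
     \<longlonglongrightarrow> (of_real (a 0) - 0 - (\<Sum>k. of_real (d k) * x ^ Suc k)) / (1 - x)"
    using x by (intro tendsto_intros A B) auto
  thus ?thesis unfolding sums_def parts by (simp add: d_def)
qed

text \<open>This takes the place of Abel's limit theorem: the series on the right-hand side of
  \<open>sums_decreasing_coeff\<close> is a uniform limit of polynomials by the Weierstrass M-test, and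
  only the quotient by \<open>1 - x\<close> excludes the point 1.\<close>

lemma continuous_on_suminf_decreasing_coeff:
  fixes a :: "nat \<Rightarrow> real"
  assumes dec: "decseq a" and lim: "a \<longlonglongrightarrow> 0"
  shows "continuous_on {x::complex. norm x \<le> 1 \<and> x \<noteq> 1} (\<lambda>x. \<Sum>k. of_real (a k) * x ^ k)"
proof -
  define D where "D = {x::complex. norm x \<le> 1 \<and> x \<noteq> 1}"
  define d where "d k = a k - a (Suc k)" for k
  have sd: "summable d"
    unfolding d_def using telescope_sums'[OF lim] by (rule sums_summable)
  have le: "norm (of_real (d k) * x ^ Suc k) \<le> d k" if "x \<in> D" for k x
    unfolding d_def using dec that by (intro norm_difference_term_le) (simp_all add: D_def)
  have "uniform_limit D (\<lambda>n x. \<Sum>k<n. of_real (d k) * x ^ Suc k)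
      (\<lambda>x. \<Sum>k. of_real (d k) * x ^ Suc k) sequentially"
    by (rule Weierstrass_m_test[OF le sd])
  hence "continuous_on D (\<lambda>x. \<Sum>k. of_real (d k) * x ^ Suc k)"
    by (rule uniform_limit_theorem[rotated])
       (auto intro!: always_eventually continuous_intros)
  hence "continuous_on D (\<lambda>x. (of_real (a 0) - (\<Sum>k. of_real (d k) * x ^ Suc k)) / (1 - x))"
    by (intro continuous_intros) (auto simp: D_def)
  thus ?thesis unfolding D_def[symmetric]
  proof (rule continuous_on_eq)
    fix x assume "x \<in> D"
    thus "(of_real (a 0) - (\<Sum>k. of_real (d k) * x ^ Suc k)) / (1 - x) = (\<Sum>k. of_real (a k) * x ^ k)"
      using sums_decreasing_coeff[OF dec lim, of x] by (auto simp: sums_iff D_def d_def)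
  qed
qed

section \<open>The polylogarithm on the closed unit disc\<close>

lemma polylog_term_of_real_mult:
  "polylog_term s (of_real r * x) k = of_real r ^ k * polylog_term s x k"
  by (simp add: polylog_term_def power_mult_distrib)

lemma polylog_zero_sums:
  assumes "norm x < 1"
  shows "(\<lambda>k. polylog_term 0 x (Suc k)) sums (x / (1 - x))"
  using sums_mult[OF geometric_sums[OF assms], of x] by (simp add: polylog_term_def)

lemma polylog_minus_one_sums:
  assumes "norm x < 1"
  shows "(\<lambda>k. polylog_term (- 1) x (Suc k)) sums (x / (1 - x)\<^sup>2)"
  using sums_mult[OF geometric_deriv_sums[OF assms], of x]
  by (simp add: polylog_term_def mult_ac power_int_minus divide_inverse)

text \<open>Splitting off one factor \<open>x\<close> leaves a power series that starts at \<open>k = 0\<close> and has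
  coefficients decreasing to zero.\<close>

lemma polylog_term_pos_order:
  "polylog_term (int (Suc p)) x (Suc k) = x * (of_real (1 / real (Suc k) ^ Suc p) * x ^ k)"
  by (simp only: polylog_term_def power_int_of_nat) (simp add: field_simps)

lemma decseq_inverse_power: "decseq (\<lambda>k. 1 / real (Suc k) ^ Suc p)"
  unfolding decseq_Suc_iff by (intro allI divide_left_mono power_mono mult_pos_pos zero_less_power) auto

lemma inverse_power_tendsto_zero: "(\<lambda>k. 1 / real (Suc k) ^ Suc p) \<longlonglongrightarrow> 0"
proof -
  have "(\<lambda>k. (1 / real (Suc k)) ^ Suc p) \<longlonglongrightarrow> 0 ^ Suc p"
    using LIMSEQ_inverse_real_of_nat by (intro tendsto_power) (simp add: inverse_eq_divide)
  thus ?thesis by (simp add: power_one_over)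
qed

lemma polylog_summable_closed_disc:
  assumes "1 \<le> s" "norm x \<le> 1" "x \<noteq> 1"
  shows "summable (\<lambda>k. polylog_term s x (Suc k))"
proof -
  define p where "p = nat (s - 1)"
  have p: "s = int (Suc p)"
    using assms(1) by (simp add: p_def)
  have "summable (\<lambda>k. of_real (1 / real (Suc k) ^ Suc p) * x ^ k)"
    using sums_decreasing_coeff[OF decseq_inverse_power inverse_power_tendsto_zero assms(2,3)]
    by (rule sums_summable)
  thus ?thesis
    unfolding p polylog_term_pos_order by (rule summable_mult)
qed

lemma polylog_summable_order_ge_2:
  assumes "2 \<le> s" "norm x \<le> 1"
  shows "summable (\<lambda>k. polylog_term s x (Suc k))"
proof (rule summable_comparison_test'[of _ 0])
  show "summable (\<lambda>k. inverse (real (Suc k)) ^ 2)"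
    using inverse_power_summable[of 2, where 'a=real] by (subst summable_Suc_iff) (simp add: power_inverse)
next
  fix k :: nat
  define p where "p = nat (s - 2)"
  have p: "s = int (p + 2)"
    using assms(1) by (simp add: p_def)
  have "norm (polylog_term s x (Suc k)) = norm x ^ Suc k * (1 / real (Suc k) ^ (p + 2))"
    unfolding polylog_term_def p power_int_of_nat by (simp only: norm_divide norm_power norm_of_nat) simp
  also have "\<dots> \<le> 1 * (1 / real (Suc k) ^ 2)"
    using assms(2) by (intro mult_mono power_le_one divide_left_mono power_increasing) auto
  finally show "norm (polylog_term s x (Suc k)) \<le> inverse (real (Suc k)) ^ 2"
    by (simp only: power_inverse inverse_eq_divide mult_1 power_one_over)
qed

lemma polylog_summable_open_disc:
  assumes "- 1 \<le> s" "norm x < 1"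
  shows "summable (\<lambda>k. polylog_term s x (Suc k))"
proof -
  consider "s = - 1" | "s = 0" | "1 \<le> s" using assms(1) by linarith
  thus ?thesis
  proof cases
    case 3
    moreover have "x \<noteq> 1" using assms(2) by auto
    ultimately show ?thesis using assms(2) by (intro polylog_summable_closed_disc) auto
  qed (use polylog_minus_one_sums[OF assms(2)] polylog_zero_sums[OF assms(2)]
       in \<open>auto simp: sums_iff\<close>)
qed

text \<open>For every order \<open>s \<ge> - 1\<close>, the polylogarithm agrees inside the disc with a function that is
  continuous on the closed disc without the point 1; the limit is the value of that function at \<open>z\<close>.\<close>

lemma polylog_radial_limit:
  assumes s: "- 1 \<le> s" and z: "norm z = 1" "z \<noteq> 1"
  shows "\<exists>A. ((\<lambda>r. polylog s (of_real r * z)) \<longlongrightarrow> A) (at_left 1)"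
proof -
  define D where "D = {x::complex. norm x \<le> 1 \<and> x \<noteq> 1}"
  have "\<exists>P. continuous_on D P \<and> (\<forall>x. norm x < 1 \<longrightarrow> polylog s x = P x)"
  proof -
    consider "s = - 1" | "s = 0" | "1 \<le> s" using s by linarith
    thus ?thesis
    proof cases
      case 1
      have "continuous_on D (\<lambda>x. x / (1 - x)\<^sup>2)"
        by (intro continuous_intros) (auto simp: D_def)
      thus ?thesis using polylog_minus_one_sums 1 by (auto simp: sums_iff polylog_def)
    next
      case 2
      have "continuous_on D (\<lambda>x. x / (1 - x))"
        by (intro continuous_intros) (auto simp: D_def)
      thus ?thesis using polylog_zero_sums 2 by (auto simp: sums_iff polylog_def)
    next
      case 3
      define p where "p = nat (s - 1)"
      have p: "s = int (Suc p)"
        using 3 by (simp add: p_def)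
      define a where "a k = 1 / real (Suc k) ^ Suc p" for k
      have a: "decseq a" "a \<longlonglongrightarrow> 0"
        using decseq_inverse_power inverse_power_tendsto_zero by (simp_all only: a_def [abs_def])
      have "continuous_on D (\<lambda>x. x * (\<Sum>k. of_real (a k) * x ^ k))"
        unfolding D_def by (intro continuous_intros continuous_on_suminf_decreasing_coeff a)
      moreover have "polylog s x = x * (\<Sum>k. of_real (a k) * x ^ k)" if "norm x < 1" for x
      proof -
        have "x \<noteq> 1" using that by auto
        hence "summable (\<lambda>k. of_real (a k) * x ^ k)"
          using sums_decreasing_coeff[OF a, of x] that by (auto simp: sums_iff)
        thus ?thesis unfolding polylog_def p polylog_term_pos_order a_def by (rule suminf_mult)
      qed
      ultimately show ?thesis by auto
    qed
  qed
  then obtain P where P: "continuous_on D P" "\<And>x. norm x < 1 \<Longrightarrow> polylog s x = P x" by auto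
  have inside: "norm (of_real r * z) < 1" if "r \<in> {0<..<1}" for r
    using that z by (simp add: norm_mult)
  have ev: "eventually (\<lambda>r::real. r \<in> {0<..<1}) (at_left 1)"
    by (rule eventually_at_left_real) simp
  have "((\<lambda>r. of_real r * z) \<longlongrightarrow> of_real 1 * z) (at_left (1::real))"
    by (intro tendsto_intros)
  hence lim: "((\<lambda>r. of_real r * z) \<longlongrightarrow> z) (at_left (1::real))"
    by simp
  have "eventually (\<lambda>r. of_real r * z \<in> D) (at_left (1::real))"
    using ev by eventually_elim (use inside in \<open>force simp: D_def\<close>)
  moreover have "z \<in> D" using z by (simp add: D_def)
  ultimately have "((\<lambda>r. P (of_real r * z)) \<longlongrightarrow> P z) (at_left 1)"
    using continuous_on_tendsto_compose[OF P(1) lim] by blast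
  hence "((\<lambda>r. polylog s (of_real r * z)) \<longlongrightarrow> P z) (at_left 1)"
    by (rule Lim_transform_eventually) (use ev in eventually_elim, use P(2) inside in auto)
  thus ?thesis by blast
qed

section \<open>The lattice terms\<close>

lemma norm_axis_vector: "norm (vector [a, 0, 0] :: real ^ 3) = \<bar>a\<bar>"
  by (simp add: norm_vec_def L2_set_def sum_3)

lemma irregular_harm_axis:
  assumes "a \<noteq> 0"
  shows "irregular_harm L M (vector [a, 0, 0]) =
     of_real (sqrt (4 * pi / (2 * real L + 1))) * sph_harm L M (pi / 2) (if a < 0 then pi else 0)
       * of_real (\<bar>a\<bar> powi (- int L - 1))"
proof -
  have "Complex (inverse \<bar>a\<bar> * a) 0 = of_real (sgn a)"
    using assms by (auto simp: complex_eq_iff sgn_real_def)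
  hence "sph_harm_dir L M (vector [a, 0, 0] /\<^sub>R norm (vector [a, 0, 0] :: real ^ 3))
       = sph_harm L M (pi / 2) (if a < 0 then pi else 0)"
    unfolding sph_harm_dir_def norm_axis_vector using assms
    by (simp add: sgn_real_def)
  thus ?thesis by (simp add: irregular_harm_def norm_axis_vector)
qed

text \<open>The part of \<open>lattice_term\<close> that does not depend on the lattice point; the last square root is the
  normalisation of \<open>irregular_harm\<close>.\<close>

definition transl_const :: "nat \<Rightarrow> nat \<Rightarrow> int \<Rightarrow> int \<Rightarrow> complex" where
  "transl_const l \<Lambda> m \<mu> =
     (-1) powi (int \<Lambda> + \<mu>)
     * of_real (sqrt ((2 * real l + 1) / (2 * real \<Lambda> + 1)))
     * of_real (sqrt (real (nat (int l + int \<Lambda> + \<mu> - m) choose nat (int \<Lambda> + \<mu>))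
                    * real (nat (int l + int \<Lambda> + m - \<mu>) choose nat (int \<Lambda> - \<mu>))))
     * of_real (sqrt (4 * pi / (2 * real (l + \<Lambda>) + 1)))"

lemma transl_coeff_axis:
  assumes "a \<noteq> 0"
  shows "transl_coeff l \<Lambda> m \<mu> (vector [a, 0, 0]) =
     transl_const l \<Lambda> m \<mu> * sph_harm (l + \<Lambda>) (m - \<mu>) (pi / 2) (if a < 0 then pi else 0)
       * of_real (\<bar>a\<bar> powi (- int (l + \<Lambda>) - 1))"
  by (simp only: transl_coeff_def irregular_harm_axis[OF assms] transl_const_def mult_ac)

text \<open>The weight \<open>n\<^sup>2\<close> raises the exponent \<open>- L - 1\<close> of the irregular harmonic by two, which gives
  the order \<open>L - 1\<close> of the polylogarithm.\<close>

lemma square_times_decay_eq_polylog_term: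
  "(of_nat (Suc k))\<^sup>2 * of_real (real (Suc k) powi (- int L - 1)) * x ^ Suc k
     = polylog_term (int L - 1) x (Suc k)"
proof -
  have "(of_nat (Suc k) :: complex)\<^sup>2 * of_nat (Suc k) powi (- int L - 1)
      = of_nat (Suc k) powi (2 + (- int L - 1))"
    by (subst power_int_add) (auto simp del: of_nat_Suc)
  also have "\<dots> = inverse (of_nat (Suc k) powi (int L - 1))"
    by (subst power_int_minus[symmetric]) simp
  finally show ?thesis
    by (simp add: polylog_term_def of_real_power_int divide_inverse mult.commute del: of_nat_Suc power_Suc)
qed

lemma lattice_term_pos:
  "lattice_term l \<Lambda> m \<mu> \<alpha> (int (Suc k)) =
     transl_const l \<Lambda> m \<mu> * sph_harm (l + \<Lambda>) (m - \<mu>) (pi / 2) pi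
       * polylog_term (int (l + \<Lambda>) - 1) (exp (- (\<i> * of_real \<alpha>))) (Suc k)"
proof -
  have e: "exp (- (\<i> * of_int (int (Suc k)) * of_real \<alpha>)) = exp (- (\<i> * of_real \<alpha>)) ^ Suc k"
    by (subst exp_of_nat_mult[symmetric]) (simp add: algebra_simps)
  show ?thesis
    unfolding lattice_term_def e square_times_decay_eq_polylog_term[symmetric]
    by (subst transl_coeff_axis) (simp_all del: of_nat_Suc of_nat_add power_Suc)
qed

lemma lattice_term_neg:
  "lattice_term l \<Lambda> m \<mu> \<alpha> (- int (Suc k)) =
     transl_const l \<Lambda> m \<mu> * sph_harm (l + \<Lambda>) (m - \<mu>) (pi / 2) 0
       * polylog_term (int (l + \<Lambda>) - 1) (exp (\<i> * of_real \<alpha>)) (Suc k)"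
proof -
  have e: "exp (- (\<i> * of_int (- int (Suc k)) * of_real \<alpha>)) = exp (\<i> * of_real \<alpha>) ^ Suc k"
    by (subst exp_of_nat_mult[symmetric]) (simp add: algebra_simps)
  show ?thesis
    unfolding lattice_term_def e square_times_decay_eq_polylog_term[symmetric]
    by (subst transl_coeff_axis) (simp_all del: of_nat_Suc of_nat_add power_Suc)
qed

lemma nonzero_int_sum_polylog:
  assumes pos: "\<And>k. f (int (Suc k)) = C * P * polylog_term s w (Suc k)"
    and neg: "\<And>k. f (- int (Suc k)) = C * Q * polylog_term s z (Suc k)"
    and w: "summable (\<lambda>k. polylog_term s w (Suc k))"
    and z: "summable (\<lambda>k. polylog_term s z (Suc k))"
  shows "nonzero_int_summable f"
    and "nonzero_int_suminf f = C * (polylog s w * P + polylog s z * Q)"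
  unfolding nonzero_int_summable_def nonzero_int_suminf_def pos neg polylog_def
    suminf_mult[OF w] suminf_mult[OF z]
  using w z by (auto intro: summable_mult simp: algebra_simps)

theorem lemma5p5:
  fixes l \<Lambda> :: nat and m \<mu> :: int and \<alpha> :: real
  assumes "\<bar>m\<bar> \<le> int l" and "\<bar>\<mu>\<bar> \<le> int \<Lambda>"
  shows
    "let s = int (l + \<Lambda>) - 1;
         C = (-1) powi (int \<Lambda> + \<mu>)
             * of_real (sqrt ((2 * real l + 1) / (2 * real \<Lambda> + 1)))
             * of_real (sqrt (real (nat (int l + int \<Lambda> + \<mu> - m) choose nat (int \<Lambda> + \<mu>))
                            * real (nat (int l + int \<Lambda> + m - \<mu>) choose nat (int \<Lambda> - \<mu>))))
             * of_real (sqrt (4 * pi / (2 * real (l + \<Lambda>) + 1)));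
         Y = sph_harm (l + \<Lambda>) (m - \<mu>);
         z = exp (\<i> * of_real \<alpha>);
         w = exp (- (\<i> * of_real \<alpha>))
     in
       (3 \<le> l + \<Lambda> \<or> (l + \<Lambda> = 2 \<and> z \<noteq> 1) \<longrightarrow>
          nonzero_int_summable (lattice_term l \<Lambda> m \<mu> \<alpha>)
          \<and> summable (\<lambda>k. polylog_term s w (Suc k))
          \<and> summable (\<lambda>k. polylog_term s z (Suc k))
          \<and> lattice_sum l \<Lambda> m \<mu> \<alpha>
              = C * (polylog s w * Y (pi / 2) pi + polylog s z * Y (pi / 2) 0))
     \<and> (\<forall>r. 0 \<le> r \<and> r < 1 \<longrightarrow>
          nonzero_int_summable (abel_term r (lattice_term l \<Lambda> m \<mu> \<alpha>))
          \<and> summable (\<lambda>k. polylog_term s (of_real r * w) (Suc k))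
          \<and> summable (\<lambda>k. polylog_term s (of_real r * z) (Suc k))
          \<and> nonzero_int_suminf (abel_term r (lattice_term l \<Lambda> m \<mu> \<alpha>))
              = C * (polylog s (of_real r * w) * Y (pi / 2) pi
                   + polylog s (of_real r * z) * Y (pi / 2) 0))
     \<and> (z \<noteq> 1 \<longrightarrow>
          (\<exists>A B.
             ((\<lambda>r. polylog s (of_real r * w)) \<longlongrightarrow> A) (at_left 1)
           \<and> ((\<lambda>r. polylog s (of_real r * z)) \<longlongrightarrow> B) (at_left 1)
           \<and> ((\<lambda>r. nonzero_int_suminf (abel_term r (lattice_term l \<Lambda> m \<mu> \<alpha>)))
                \<longlongrightarrow> C * (A * Y (pi / 2) pi + B * Y (pi / 2) 0)) (at_left 1)))"
proof -
  define s where "s = int (l + \<Lambda>) - 1"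
  define C where "C = transl_const l \<Lambda> m \<mu>"
  define P where "P = sph_harm (l + \<Lambda>) (m - \<mu>) (pi / 2) pi"
  define Q where "Q = sph_harm (l + \<Lambda>) (m - \<mu>) (pi / 2) 0"
  define z where "z = exp (\<i> * of_real \<alpha>)"
  define w where "w = exp (- (\<i> * of_real \<alpha>))"
  define f where "f = lattice_term l \<Lambda> m \<mu> \<alpha>"
  have norms: "norm z = 1" "norm w = 1"
    by (simp_all add: z_def w_def norm_exp_eq_Re)
  have w_z: "w = inverse z"
    by (simp add: z_def w_def exp_minus)
  have s: "- 1 \<le> s" by (simp add: s_def)
  have pos: "f (int (Suc k)) = C * P * polylog_term s w (Suc k)" for k
    unfolding f_def C_def P_def s_def w_def by (rule lattice_term_pos)
  have neg: "f (- int (Suc k)) = C * Q * polylog_term s z (Suc k)" for k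
    unfolding f_def C_def Q_def s_def z_def by (rule lattice_term_neg)

  \<comment> \<open>Order at least 2 gives absolute convergence even at the point 1; order 1 needs cancellation.\<close>
  have boundary: "nonzero_int_summable f \<and> summable (\<lambda>k. polylog_term s w (Suc k))
      \<and> summable (\<lambda>k. polylog_term s z (Suc k))
      \<and> nonzero_int_suminf f = C * (polylog s w * P + polylog s z * Q)"
    if "3 \<le> l + \<Lambda> \<or> (l + \<Lambda> = 2 \<and> z \<noteq> 1)"
  proof -
    have "summable (\<lambda>k. polylog_term s x (Suc k))" if "x = w \<or> x = z" for x
    proof (cases "3 \<le> l + \<Lambda>")
      case True
      thus ?thesis using that norms by (intro polylog_summable_order_ge_2) (auto simp: s_def)
    next
      case False
      hence "z \<noteq> 1" "s = 1" using \<open>3 \<le> l + \<Lambda> \<or> _\<close> by (auto simp: s_def)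
      thus ?thesis using that norms w_z by (intro polylog_summable_closed_disc) auto
    qed
    hence "summable (\<lambda>k. polylog_term s w (Suc k))" "summable (\<lambda>k. polylog_term s z (Suc k))"
      by auto
    thus ?thesis using nonzero_int_sum_polylog[of f C P s w Q z, OF pos neg] by auto
  qed

  have abel: "nonzero_int_summable (abel_term r f)
      \<and> summable (\<lambda>k. polylog_term s (of_real r * w) (Suc k))
      \<and> summable (\<lambda>k. polylog_term s (of_real r * z) (Suc k))
      \<and> nonzero_int_suminf (abel_term r f)
          = C * (polylog s (of_real r * w) * P + polylog s (of_real r * z) * Q)"
    if "0 \<le> r" "r < 1" for r
  proof -
    have sw: "summable (\<lambda>k. polylog_term s (of_real r * w) (Suc k))"
      and sz: "summable (\<lambda>k. polylog_term s (of_real r * z) (Suc k))"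
      using that norms by (auto intro!: polylog_summable_open_disc s simp: norm_mult)
    have n: "nat \<bar>int (Suc k)\<bar> = Suc k" "nat \<bar>- int (Suc k)\<bar> = Suc k" for k by simp_all
    have "abel_term r f (int (Suc k)) = C * P * polylog_term s (of_real r * w) (Suc k)"
      and "abel_term r f (- int (Suc k)) = C * Q * polylog_term s (of_real r * z) (Suc k)" for k
      unfolding abel_term_def n pos neg polylog_term_of_real_mult by (simp_all only: mult_ac)
    from nonzero_int_sum_polylog[of "abel_term r f", OF this sw sz] sw sz show ?thesis by blast
  qed

  have limit: "\<exists>A B. ((\<lambda>r. polylog s (of_real r * w)) \<longlongrightarrow> A) (at_left 1)
      \<and> ((\<lambda>r. polylog s (of_real r * z)) \<longlongrightarrow> B) (at_left 1)
      \<and> ((\<lambda>r. nonzero_int_suminf (abel_term r f)) \<longlongrightarrow> C * (A * P + B * Q)) (at_left 1)"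
    if z1: "z \<noteq> 1"
  proof -
    have "w \<noteq> 1" using z1 w_z by simp
    then obtain A where A: "((\<lambda>r. polylog s (of_real r * w)) \<longlongrightarrow> A) (at_left 1)"
      using polylog_radial_limit[OF s norms(2)] by blast
    obtain B where B: "((\<lambda>r. polylog s (of_real r * z)) \<longlongrightarrow> B) (at_left 1)"
      using polylog_radial_limit[OF s norms(1) z1] by blast
    have "((\<lambda>r. C * (polylog s (of_real r * w) * P + polylog s (of_real r * z) * Q))
        \<longlongrightarrow> C * (A * P + B * Q)) (at_left 1)"
      by (intro tendsto_intros A B)
    moreover have "eventually (\<lambda>r::real. r \<in> {0<..<1}) (at_left 1)"
      by (rule eventually_at_left_real) simp
    hence "eventually (\<lambda>r. C * (polylog s (of_real r * w) * P + polylog s (of_real r * z) * Q)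
        = nonzero_int_suminf (abel_term r f)) (at_left 1)"
      by eventually_elim (use abel in auto)
    ultimately have "((\<lambda>r. nonzero_int_suminf (abel_term r f)) \<longlongrightarrow> C * (A * P + B * Q)) (at_left 1)"
      by (rule Lim_transform_eventually)
    with A B show ?thesis by blast
  qed

  show ?thesis
    unfolding Let_def transl_const_def[symmetric] lattice_sum_def
    unfolding s_def[symmetric] C_def[symmetric] P_def[symmetric] Q_def[symmetric]
      z_def[symmetric] w_def[symmetric] f_def[symmetric]
    by (rule conjI[OF impI conjI[OF allI[OF impI] impI]])
       (erule boundary, erule conjE, erule (1) abel, erule limit)
qed

end
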